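(* Let $\mathbb{S}$ be a complex semi-alternative algebra of dimension $4$. Then $\mathbb{S}$ is assosymmetric or it is isomorphic to one of the following non-assosymmetric algebras (given in a basis $e_1,e_2,e_3,e_4$; all products of basis elements not listed are zero): $\mathbb{S}_{01}$: $e_1e_2=e_3$, $e_2e_1=-e_3$, $e_1e_4=2e_1$, $e_2e_4=2e_2$, $e_4e_3=2e_3$, $e_4e_4=2e_4$; $\mathbb{S}_{02}$: $e_1e_2=e_3$, $e_2e_1=-e_3$, $e_1e_4=2e_1$, $e_2e_4=2e_2+e_3$, $e_4e_2=e_3$, $e_4e_3=2e_3$, $e_4e_4=-4e_1+2e_4$; $\mathbb{S}_{03}$: $e_1e_2=e_3$, $e_2e_1=-e_3$, $e_1e_4=2e_1$, $e_2e_4=2e_2$, $e_4e_3=2e_3$, $e_4e_4=e_3+2e_4$; $\mathbb{S}_{04}$: $e_1e_2=e_3$, $e_2e_1=-e_3$, $e_4e_1=-2e_1$, $e_4e_2=-2e_2$, $e_3e_4=-2e_3$, $e_4e_4=-2e_4$; $\mathbb{S}_{05}$: $e_1e_2=e_3$, $e_2e_1=-e_3$, $e_4e_1=-2e_1$, $e_2e_4=e_3$, $e_4e_2=-2e_2+e_3$, $e_3e_4=-2e_3$, $e_4e_4=-4e_1-2e_4$; $\mathbb{S}_{06}$: $e_1e_2=e_3$, $e_2e_1=-e_3$, $e_4e_1=-2e_1$, $e_4e_2=-2e_2$, $e_3e_4=-2e_3$, $e_4e_4=e_3-2e_4$.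
   Context: Write $(x,y,z)=(xy)z-x(yz)$. An algebra is semi-alternative if $(x,y,z)=(y,z,x)$ for all $x,y,z$. An algebra is assosymmetric if $(x,y,z)=(y,x,z)=(x,z,y)$ for all $x,y,z$. *)

theory Defs
  imports "HOL-Analysis.Analysis"
begin

text \<open>Algebras are neither assumed associative nor unital: a complex vector space on a type
  together with a bilinear product.\<close>

locale complex_algebra = vector_space scale
  for scale :: "complex \<Rightarrow> 'a::ab_group_add \<Rightarrow> 'a" +
  fixes mul :: "'a \<Rightarrow> 'a \<Rightarrow> 'a"
  assumes linear_mul_right: "\<And>x. Vector_Spaces.linear scale scale (\<lambda>y. mul x y)"
    and linear_mul_left: "\<And>y. Vector_Spaces.linear scale scale (\<lambda>x. mul x y)"

definition associator :: "('a \<Rightarrow> 'a \<Rightarrow> 'a) \<Rightarrow> 'a \<Rightarrow> 'a \<Rightarrow> 'a \<Rightarrow> 'a::ab_group_add" where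
  "associator mul x y z = mul (mul x y) z - mul x (mul y z)"

definition semi_alternative :: "('a \<Rightarrow> 'a \<Rightarrow> 'a::ab_group_add) \<Rightarrow> bool" where
  "semi_alternative mul \<longleftrightarrow> (\<forall>x y z. associator mul x y z = associator mul y z x)"

definition assosymmetric :: "('a \<Rightarrow> 'a \<Rightarrow> 'a::ab_group_add) \<Rightarrow> bool" where
  "assosymmetric mul \<longleftrightarrow>
     (\<forall>x y z. associator mul x y z = associator mul y x z \<and>
              associator mul y x z = associator mul x z y)"

definition algebra_isomorphic ::
  "(complex \<Rightarrow> 'a::ab_group_add \<Rightarrow> 'a) \<Rightarrow> ('a \<Rightarrow> 'a \<Rightarrow> 'a) \<Rightarrow>
   (complex \<Rightarrow> 'b::ab_group_add \<Rightarrow> 'b) \<Rightarrow> ('b \<Rightarrow> 'b \<Rightarrow> 'b) \<Rightarrow> bool" where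
  "algebra_isomorphic scale\<^sub>1 mul\<^sub>1 scale\<^sub>2 mul\<^sub>2 \<longleftrightarrow>
     (\<exists>f. Vector_Spaces.linear scale\<^sub>1 scale\<^sub>2 f \<and> bij f \<and>
          (\<forall>x y. f (mul\<^sub>1 x y) = mul\<^sub>2 (f x) (f y)))"

text \<open>The concrete algebras live on \<open>complex ^ 4\<close>. The elements of the index type \<open>4\<close> are
  1, 2, 3 and 4, where 4 = 0 as arithmetic is modulo 4.\<close>

abbreviation e :: "4 \<Rightarrow> complex ^ 4" where
  "e i \<equiv> axis i 1"

text \<open>The product with \<open>e i\<close> times \<open>e j\<close> equal to \<open>v\<close> for each entry \<open>((i, j), v)\<close> of the table
  and equal to 0 for all pairs \<open>(i, j)\<close> without an entry, extended bilinearly.\<close>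

definition table_mul ::
  "((4 \<times> 4) \<times> (complex ^ 4)) list \<Rightarrow> complex ^ 4 \<Rightarrow> complex ^ 4 \<Rightarrow> complex ^ 4" where
  "table_mul tab x y =
     (\<Sum>i\<in>UNIV. \<Sum>j\<in>UNIV.
        (x $ i * y $ j) *s (case map_of tab (i, j) of None \<Rightarrow> 0 | Some v \<Rightarrow> v))"

definition S01 :: "complex ^ 4 \<Rightarrow> complex ^ 4 \<Rightarrow> complex ^ 4" where
  "S01 = table_mul
     [((1, 2), e 3), ((2, 1), - e 3), ((1, 4), 2 *s e 1), ((2, 4), 2 *s e 2),
      ((4, 3), 2 *s e 3), ((4, 4), 2 *s e 4)]"

definition S02 :: "complex ^ 4 \<Rightarrow> complex ^ 4 \<Rightarrow> complex ^ 4" where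
  "S02 = table_mul
     [((1, 2), e 3), ((2, 1), - e 3), ((1, 4), 2 *s e 1), ((2, 4), 2 *s e 2 + e 3),
      ((4, 2), e 3), ((4, 3), 2 *s e 3), ((4, 4), (- 4) *s e 1 + 2 *s e 4)]"

definition S03 :: "complex ^ 4 \<Rightarrow> complex ^ 4 \<Rightarrow> complex ^ 4" where
  "S03 = table_mul
     [((1, 2), e 3), ((2, 1), - e 3), ((1, 4), 2 *s e 1), ((2, 4), 2 *s e 2),
      ((4, 3), 2 *s e 3), ((4, 4), e 3 + 2 *s e 4)]"

definition S04 :: "complex ^ 4 \<Rightarrow> complex ^ 4 \<Rightarrow> complex ^ 4" where
  "S04 = table_mul
     [((1, 2), e 3), ((2, 1), - e 3), ((4, 1), (- 2) *s e 1), ((4, 2), (- 2) *s e 2),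
      ((3, 4), (- 2) *s e 3), ((4, 4), (- 2) *s e 4)]"

definition S05 :: "complex ^ 4 \<Rightarrow> complex ^ 4 \<Rightarrow> complex ^ 4" where
  "S05 = table_mul
     [((1, 2), e 3), ((2, 1), - e 3), ((4, 1), (- 2) *s e 1), ((2, 4), e 3),
      ((4, 2), (- 2) *s e 2 + e 3), ((3, 4), (- 2) *s e 3),
      ((4, 4), (- 4) *s e 1 + (- 2) *s e 4)]"

definition S06 :: "complex ^ 4 \<Rightarrow> complex ^ 4 \<Rightarrow> complex ^ 4" where
  "S06 = table_mul
     [((1, 2), e 3), ((2, 1), - e 3), ((4, 1), (- 2) *s e 1), ((4, 2), (- 2) *s e 2),
      ((3, 4), (- 2) *s e 3), ((4, 4), e 3 + (- 2) *s e 4)]"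

end

(* In a semi-alternative algebra J(x,y,z) = (x,y,z) - (y,x,z) is alternating, and the algebra is
   assosymmetric iff J = 0. The commutator bracket has Jacobiator 3J, and the Teichmueller identity
   together with cyclicity gives the Malcev identity J(w,[w,p],q) = -[w,J(w,p,q)].

   In dimension 4 an eigenvector argument based on this identity shows that J(w,x,y) lies in the
   span of w, x, y only if it is 0. So if t = J(w,x,y) is not 0, then w, x, y, t is a basis; the
   Malcev identity then forces J to vanish as soon as one argument is t, makes t span an ideal for
   the bracket, and leaves only one bracket up to isomorphism: namely
   [e1,e2] = 2e3, [e1,e4] = 2e1, [e2,e4] = 2e2, [e4,e3] = 2e3.

   An identity linear in the anticommutator expresses the anticommutators of the ei by
   the coordinates of e4^2, say p, q, r and 2 sigma, and cyclicity of the associator of e1, e4, e4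
   gives sigma^2 = 1. A change of basis reduces (p,q,r) to (-4,0,0), (0,0,0) or (0,0,1). *)

theory Submission
  imports Defs
begin

section \<open>Bilinear calculus for the commutator, the anticommutator and
  \<open>jac\<close>\<close>

context complex_algebra
begin

notation scale (infixr "\<cdot>" 75)

lemma mul_add_left: "mul (x + y) z = mul x z + mul y z"
  by (rule Vector_Spaces.linear.axioms(3)[OF linear_mul_left, THEN module_hom.add])

lemma mul_add_right: "mul x (y + z) = mul x y + mul x z"
  by (rule Vector_Spaces.linear.axioms(3)[OF linear_mul_right, THEN module_hom.add])

lemma mul_scale_left: "mul (k \<cdot> x) y = k \<cdot> mul x y"
  by (rule Vector_Spaces.linear.axioms(3)[OF linear_mul_left, THEN module_hom.scale])

lemma mul_scale_right: "mul x (k \<cdot> y) = k \<cdot> mul x y"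
  by (rule Vector_Spaces.linear.axioms(3)[OF linear_mul_right, THEN module_hom.scale])

lemma mul_zero_left: "mul 0 y = 0"
  using mul_scale_left[of 0 0 y] by simp

lemma mul_zero_right: "mul x 0 = 0"
  using mul_scale_right[of x 0 0] by simp

lemma mul_minus_left: "mul (- x) y = - mul x y"
  using mul_add_left[of x "- x" y] by (simp add: mul_zero_left add_eq_0_iff)

lemma mul_minus_right: "mul x (- y) = - mul x y"
  using mul_add_right[of x y "- y"] by (simp add: mul_zero_right add_eq_0_iff)

lemma mul_diff_left: "mul (x - y) z = mul x z - mul y z"
  using mul_add_left[of x "- y" z] by (simp add: mul_minus_left)

lemma mul_diff_right: "mul x (y - z) = mul x y - mul x z"
  using mul_add_right[of x y "- z"] by (simp add: mul_minus_right)

lemmas mul_bilinear = mul_add_left mul_add_right mul_scale_left mul_scale_right mul_zero_left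
  mul_zero_right mul_minus_left mul_minus_right mul_diff_left mul_diff_right

definition br :: "'a \<Rightarrow> 'a \<Rightarrow> 'a" where
  "br x y = mul x y - mul y x"

definition ac :: "'a \<Rightarrow> 'a \<Rightarrow> 'a" where
  "ac x y = mul x y + mul y x"

definition jac :: "'a \<Rightarrow> 'a \<Rightarrow> 'a \<Rightarrow> 'a" where
  "jac x y z = associator mul x y z - associator mul y x z"

lemma br_skew: "br y x = - br x y" and br_self [simp]: "br x x = 0"
  by (simp_all add: br_def)

lemma ac_commute: "ac y x = ac x y"
  by (simp add: ac_def add.commute)

lemma br_bilinear:
  "br (x + y) z = br x z + br y z" "br x (y + z) = br x y + br x z"
  "br (x - y) z = br x z - br y z" "br x (y - z) = br x y - br x z"
  "br (- x) y = - br x y" "br x (- y) = - br x y"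
  "br (k \<cdot> x) y = k \<cdot> br x y" "br x (k \<cdot> y) = k \<cdot> br x y"
  "br 0 x = 0" "br x 0 = 0"
  by (simp_all add: br_def mul_bilinear algebra_simps)

lemma ac_bilinear:
  "ac (x + y) z = ac x z + ac y z" "ac x (y + z) = ac x y + ac x z"
  "ac (x - y) z = ac x z - ac y z" "ac x (y - z) = ac x y - ac x z"
  "ac (- x) y = - ac x y" "ac x (- y) = - ac x y"
  "ac (k \<cdot> x) y = k \<cdot> ac x y" "ac x (k \<cdot> y) = k \<cdot> ac x y"
  "ac 0 x = 0" "ac x 0 = 0"
  by (simp_all add: ac_def mul_bilinear algebra_simps)

lemma jac_trilinear:
  "jac (x + x') y z = jac x y z + jac x' y z" "jac x (y + y') z = jac x y z + jac x y' z"
  "jac x y (z + z') = jac x y z + jac x y z'"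
  "jac (x - x') y z = jac x y z - jac x' y z" "jac x (y - y') z = jac x y z - jac x y' z"
  "jac x y (z - z') = jac x y z - jac x y z'"
  "jac (- x) y z = - jac x y z" "jac x (- y) z = - jac x y z" "jac x y (- z) = - jac x y z"
  "jac (k \<cdot> x) y z = k \<cdot> jac x y z" "jac x (k \<cdot> y) z = k \<cdot> jac x y z"
  "jac x y (k \<cdot> z) = k \<cdot> jac x y z"
  "jac 0 y z = 0" "jac x 0 z = 0" "jac x y 0 = 0"
  by (simp_all add: jac_def associator_def mul_bilinear algebra_simps)

lemma scale_3: "3 \<cdot> x = x + x + x"
proof -
  have "(1 + 1 + 1) \<cdot> x = x + x + x"
    by (simp only: scale_left_distrib scale_one)
  then show ?thesis by simp
qed

lemma scale_2: "2 \<cdot> x = x + x"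
proof -
  have "(1 + 1) \<cdot> x = x + x"
    by (simp only: scale_left_distrib scale_one)
  then show ?thesis by simp
qed

lemma eq_uminus_self_iff: "x = - x \<longleftrightarrow> x = 0" for x :: 'a
proof -
  have "x = - x \<longleftrightarrow> 2 \<cdot> x = 0"
    by (simp only: scale_2 eq_neg_iff_add_eq_0)
  then show ?thesis by simp
qed

end

section \<open>Identities in semi-alternative algebras of any dimension\<close>

locale semi_alternative_algebra = complex_algebra +
  assumes semi_alternative: "semi_alternative mul"
begin

lemma assoc_cyclic: "associator mul y z x = associator mul x y z"
  using semi_alternative unfolding semi_alternative_def by metis

lemma jac_skew12: "jac y x z = - jac x y z"
  by (simp add: jac_def)

lemma jac_cyclic: "jac y z x = jac x y z"
  unfolding jac_def using assoc_cyclic[of y z x] assoc_cyclic[of x z y] assoc_cyclic[of z y x]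
  by simp

lemma jac_skew23: "jac x z y = - jac x y z"
  using jac_skew12[of x z y] jac_cyclic[of x y z] jac_cyclic[of z x y] by simp

lemma jac_same [simp]: "jac x x y = 0" "jac x y x = 0" "jac y x x = 0"
  using jac_cyclic[of x x y] jac_cyclic[of x y x] by (simp_all add: jac_def)

text \<open>In any algebra the left side is the signed sum of the six associators of x, y, z;
  cyclicity merges them into three copies of \<open>jac\<close>.\<close>

lemma jacobiator: "br (br x y) z + br (br y z) x + br (br z x) y = 3 \<cdot> jac x y z"
proof -
  have "br (br x y) z + br (br y z) x + br (br z x) y =
      associator mul x y z + associator mul y z x + associator mul z x y
      - associator mul y x z - associator mul x z y - associator mul z y x"
    by (simp add: br_def associator_def mul_bilinear algebra_simps)
  then show ?thesis
    using assoc_cyclic[of x y z] assoc_cyclic[of z x y] assoc_cyclic[of y x z] assoc_cyclic[of z y x]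
    by (simp add: jac_def scale_3 algebra_simps)
qed

text \<open>The four cyclic shifts of the Teichmueller identity form a linear system for four
  associators with a product as first argument; this is its solution for one of them.\<close>

lemma assoc_mul:
  "3 \<cdot> associator mul (mul w x) y z =
     mul w (associator mul x y z) + 2 \<cdot> mul (associator mul x y z) w
     + 2 \<cdot> mul x (associator mul w y z) + mul (associator mul w y z) x
     + br (associator mul w x y) z + br y (associator mul w x z)"
proof -
  let ?A = "associator mul"
  \<comment> \<open>The Teichmueller identity of an arbitrary algebra, with every product rotated
    into the first argument.\<close>
  have teich: "?A (mul w x) y z - ?A (mul x y) z w + ?A (mul y z) w x
      = mul w (?A x y z) + mul (?A w x y) z" for w x y z
  proof -
    have "?A (mul w x) y z - ?A w (mul x y) z + ?A w x (mul y z)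
        = mul w (?A x y z) + mul (?A w x y) z"
      by (simp add: associator_def mul_bilinear algebra_simps)
    then show ?thesis
      using assoc_cyclic[of "mul x y" z w] assoc_cyclic[of w "mul x y" z]
        assoc_cyclic[of "mul y z" w x] assoc_cyclic[of w x "mul y z"] by metis
  qed
  have f0: "?A (mul w x) y z - ?A (mul x y) z w + ?A (mul y z) w x
      = mul w (?A x y z) + mul (?A w x y) z"
    by (rule teich)
  have f1: "?A (mul x y) z w - ?A (mul y z) w x + ?A (mul z w) x y
      = mul x (?A w y z) + mul (?A x y z) w"
    using teich[of x y z w] by (metis assoc_cyclic)
  have f2: "?A (mul y z) w x - ?A (mul z w) x y + ?A (mul w x) y z
      = mul y (?A w x z) + mul (?A w y z) x"
    using teich[of y z w x] by (metis assoc_cyclic)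
  have f3: "?A (mul z w) x y - ?A (mul w x) y z + ?A (mul x y) z w
      = mul z (?A w x y) + mul (?A w x z) y"
    using teich[of z w x y] by (metis assoc_cyclic)
  let ?a0 = "?A (mul w x) y z" and ?a1 = "?A (mul x y) z w" and ?a2 = "?A (mul y z) w x"
    and ?a3 = "?A (mul z w) x y"
  \<comment> \<open>The combination \<open>f0 + 2 f1 + f2 - f3\<close> eliminates
    \<open>?a1\<close>, \<open>?a2\<close> and \<open>?a3\<close>.\<close>
  have "3 \<cdot> ?a0 = (?a0 - ?a1 + ?a2) + (?a1 - ?a2 + ?a3) + (?a1 - ?a2 + ?a3)
      + (?a2 - ?a3 + ?a0) - (?a3 - ?a0 + ?a1)"
    by (simp add: scale_3 algebra_simps)
  then show ?thesis
    unfolding f0 f1 f2 f3 br_def scale_2 by (simp add: algebra_simps)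
qed

text \<open>Antisymmetrizing \<open>assoc_mul\<close> in w, x produces the bracket in the first
  argument; antisymmetrizing in y, z then turns the remaining associators into
  \<open>jac\<close>.\<close>

lemma jac_br:
  "3 \<cdot> jac (br w x) y z = br (jac x y z) w + br x (jac w y z)
    + 2 \<cdot> br (jac w x y) z - 2 \<cdot> br (jac w x z) y"
proof -
  let ?A = "associator mul"
  have *: "3 \<cdot> ?A (br w x) y z
      = br (?A x y z) w + br x (?A w y z) + br (jac w x y) z + br y (jac w x z)" for y z
  proof -
    have "3 \<cdot> ?A (br w x) y z = 3 \<cdot> ?A (mul w x) y z - 3 \<cdot> ?A (mul x w) y z"
      by (simp add: associator_def br_def mul_bilinear algebra_simps)
    then show ?thesis
      unfolding assoc_mul jac_def br_def scale_2
      by (simp add: mul_bilinear algebra_simps)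
  qed
  have alt: "jac u y z = ?A u y z - ?A u z y" for u
    using assoc_cyclic[of z y u] assoc_cyclic[of y u z] by (simp add: jac_def)
  have "3 \<cdot> (?A (br w x) y z - ?A (br w x) z y)
      = (br (?A x y z) w + br x (?A w y z) + br (jac w x y) z + br y (jac w x z))
        - (br (?A x z y) w + br x (?A w z y) + br (jac w x z) y + br z (jac w x y))"
    by (simp only: * scale_right_diff_distrib)
  then show ?thesis
    unfolding alt[of "br w x"] alt[of x] alt[of w] scale_2 br_skew[of "jac w x z" y] br_skew[of "jac w x y" z]
    by (simp add: br_bilinear algebra_simps)
qed

text \<open>In \<open>jac_br\<close> with w repeated, alternation leaves only multiples of
  \<open>br w (jac w p q)\<close>, which add up to three.\<close>

lemma malcev: "jac w (br w p) q = - br w (jac w p q)"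
proof -
  have "3 \<cdot> jac (br w p) w q = 3 \<cdot> br w (jac w p q)"
    using jac_br[of w p w q] unfolding jac_skew12[of p w q] scale_2 scale_3
    by (simp add: br_bilinear br_skew[of w "jac w p q"])
  then show ?thesis
    using jac_skew12[of w "br w p" q] by simp
qed

text \<open>Polarization of \<open>malcev\<close> in w.\<close>

lemma malcev_linearized:
  "jac w (br v p) q + jac v (br w p) q = - br w (jac v p q) - br v (jac w p q)"
  using malcev[of "w + v" p q] malcev[of w p q] malcev[of v p q]
  by (simp add: br_bilinear jac_trilinear algebra_simps eq_neg_iff_add_eq_0)

text \<open>Once the bracket is known, this is a system of linear equations for the anticommutator,
  which \<open>table_exists\<close> solves.\<close>

lemma ac_br:
  "2 \<cdot> br (ac x y) z + br x (ac y z) + br y (ac x z) = 3 \<cdot> (ac x (br y z) + ac y (br x z))"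
proof -
  let ?A = "associator mul"
  \<comment> \<open>The associator symmetrized in x and y has three rotations, equal by cyclicity.
    Their weights 2, 2, -4 sum to zero and cancel all terms with two brackets or two
    anticommutators.\<close>
  have "0 = ?A x y z + ?A y x z + ?A x y z + ?A y x z
      + ?A z x y + ?A z y x + ?A z x y + ?A z y x - ?A y z x - ?A x z y
      - ?A y z x - ?A x z y - ?A y z x - ?A x z y - ?A y z x - ?A x z y"
    using assoc_cyclic[of x y z] assoc_cyclic[of z x y] assoc_cyclic[of y x z] assoc_cyclic[of z y x]
    by simp
  then show ?thesis
    unfolding scale_2 scale_3
    by (simp add: associator_def br_def ac_def mul_bilinear algebra_simps)
qed

end

section \<open>Bases and coordinates in dimension 4\<close>

locale semi_alternative_algebra_4 = semi_alternative_algebra +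
  assumes dim_4: "dim (UNIV :: 'a set) = 4"
begin

text \<open>Stated for the tuple rather than for a set, so that distinctness of the four vectors is
  included.\<close>

definition indep4 :: "'a \<Rightarrow> 'a \<Rightarrow> 'a \<Rightarrow> 'a \<Rightarrow> bool" where
  "indep4 a b c d \<longleftrightarrow>
    (\<forall>k l m n. k \<cdot> a + l \<cdot> b + m \<cdot> c + n \<cdot> d = 0 \<longrightarrow> k = 0 \<and> l = 0 \<and> m = 0 \<and> n = 0)"

definition comb4 :: "'a \<Rightarrow> 'a \<Rightarrow> 'a \<Rightarrow> 'a \<Rightarrow> complex ^ 4 \<Rightarrow> 'a" where
  "comb4 a b c d v = v $ 1 \<cdot> a + v $ 2 \<cdot> b + v $ 3 \<cdot> c + v $ 4 \<cdot> d"

lemma linear_comb4: "Vector_Spaces.linear (*s) scale (comb4 a b c d)"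
proof -
  interpret p: vector_space_pair "(*s) :: complex \<Rightarrow> complex ^ 4 \<Rightarrow> complex ^ 4" scale ..
  show ?thesis
    by (rule Vector_Spaces.linear.intro)
      (unfold_locales, simp_all add: comb4_def algebra_simps)
qed

lemma indep4D:
  assumes "indep4 a b c d" "k \<cdot> a + l \<cdot> b + m \<cdot> c + n \<cdot> d = 0"
  shows "k = 0" "l = 0" "m = 0" "n = 0"
  using assms unfolding indep4_def by blast+

lemma indep4_eq_iff:
  assumes "indep4 a b c d"
  shows "k \<cdot> a + l \<cdot> b + m \<cdot> c + n \<cdot> d = k' \<cdot> a + l' \<cdot> b + m' \<cdot> c + n' \<cdot> d \<longleftrightarrow>
    k = k' \<and> l = l' \<and> m = m' \<and> n = n'"
proof
  assume "k \<cdot> a + l \<cdot> b + m \<cdot> c + n \<cdot> d = k' \<cdot> a + l' \<cdot> b + m' \<cdot> c + n' \<cdot> d"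
  then have "(k - k') \<cdot> a + (l - l') \<cdot> b + (m - m') \<cdot> c + (n - n') \<cdot> d = 0"
    by (simp add: algebra_simps)
  from indep4D[OF assms this] show "k = k' \<and> l = l' \<and> m = m' \<and> n = n'" by simp
qed auto

lemma bij_comb4:
  assumes "indep4 a b c d"
  shows "bij (comb4 a b c d)"
proof -
  interpret lf: Vector_Spaces.linear "(*s)" scale "comb4 a b c d"
    by (rule linear_comb4)
  have inj: "inj (comb4 a b c d)"
    by (rule injI) (simp add: comb4_def indep4_eq_iff[OF assms] vec_eq_iff forall_4)
  obtain B where B: "independent B" "span B = UNIV" "card B = 4"
    using basis_exists[of UNIV] dim_4 by (metis top.extremum_uniqueI)
  interpret fd: finite_dimensional_vector_space scale B
    using B by unfold_locales (auto intro: card_ge_0_finite)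
  interpret pr: finite_dimensional_vector_space_pair
    "(*s) :: complex \<Rightarrow> complex ^ 4 \<Rightarrow> complex ^ 4" cart_basis scale B ..
  have "surj (comb4 a b c d)"
    by (rule pr.linear_injective_imp_surjective[OF linear_comb4 inj])
      (simp add: dim_4 vec_dim_card del: vec.dim_UNIV fd.dim_UNIV)
  with inj show ?thesis by (simp add: bij_def)
qed

lemma indep4_obtain:
  assumes "indep4 a b c d"
  obtains k l m n where "v = k \<cdot> a + l \<cdot> b + m \<cdot> c + n \<cdot> d"
  using bij_comb4[OF assms] by (metis bij_pointE comb4_def)

section \<open>Eigenvectors of \<open>jac\<close> and the basis obtained from a nonzero value of
  it\<close>

text \<open>If \<open>u = br x t\<close> were nonzero, \<open>malcev\<close> would make t and u
  eigenvectors for -1 and 1 of the map sending v to \<open>jac x v y\<close>, whose kernel contains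
  x and y. In the resulting basis the Malcev identity puts contradictory constraints on
  \<open>br x y\<close>.\<close>

lemma br_eigen_eq_0:
  assumes t: "jac t x y = t" "t \<noteq> 0"
  shows "br x t = 0"
proof (rule ccontr)
  assume nz: "br x t \<noteq> 0"
  define u where "u = br x t"
  have Et: "jac x t y = - t"
    using jac_skew12[of x t y] t by simp
  have Eu: "jac x u y = u"
    using malcev[of x t y] Et by (simp add: u_def br_bilinear)
  have ind: "indep4 x y t u"
    unfolding indep4_def
  proof (intro allI impI)
    fix k l m n assume eq: "k \<cdot> x + l \<cdot> y + m \<cdot> t + n \<cdot> u = 0"
    \<comment> \<open>The map sending v to \<open>jac x v y\<close> kills x and y; applying it twice
      separates the eigenvalues -1 and 1, hence m and n.\<close>
    have "jac x (k \<cdot> x + l \<cdot> y + m \<cdot> t + n \<cdot> u) y = 0"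
      by (simp add: eq jac_trilinear)
    then have 1: "n \<cdot> u - m \<cdot> t = 0"
      by (simp add: jac_trilinear Et Eu)
    have "jac x (n \<cdot> u - m \<cdot> t) y = 0"
      by (simp add: 1 jac_trilinear)
    then have 2: "n \<cdot> u + m \<cdot> t = 0"
      by (simp add: jac_trilinear Et Eu)
    have "2 \<cdot> n \<cdot> u = (n \<cdot> u - m \<cdot> t) + (n \<cdot> u + m \<cdot> t)"
      by (simp only: scale_2) simp
    then have "n = 0" using 1 2 nz by (simp add: u_def)
    then have "m = 0" using 1 t by simp
    have xy: "k \<cdot> x + l \<cdot> y = 0" using eq \<open>n = 0\<close> \<open>m = 0\<close> by simp
    have "jac t (k \<cdot> x + l \<cdot> y) y = 0" "jac t x (k \<cdot> x + l \<cdot> y) = 0"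
      by (simp_all add: xy jac_trilinear)
    then have "k = 0" "l = 0"
      using t by (simp_all add: jac_trilinear)
    then show "k = 0 \<and> l = 0 \<and> m = 0 \<and> n = 0" using \<open>n = 0\<close> \<open>m = 0\<close> by simp
  qed
  obtain a b c d where xy: "br x y = a \<cdot> x + b \<cdot> y + c \<cdot> t + d \<cdot> u"
    using indep4_obtain[OF ind] .
  \<comment> \<open>This removes the t- and u-coordinates of \<open>br x y\<close>.\<close>
  have "jac x (br x y) y = 0"
    using malcev[of x y y] by (simp add: br_bilinear)
  then have "0 \<cdot> x + 0 \<cdot> y + (- c) \<cdot> t + d \<cdot> u = 0"
    by (simp add: xy jac_trilinear Et Eu)
  from indep4D[OF ind this] have "c = 0" "d = 0" by simp_all
  have xyt: "jac x y t = t"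
    using t jac_cyclic[of x y t] by simp
  \<comment> \<open>Only the y-coordinate of \<open>br x y\<close> contributes on the left, so u
    would be a multiple of t.\<close>
  have "jac x (br x y) t = - u"
    using malcev[of x y t] by (simp add: xyt u_def)
  then have "b \<cdot> t = - u"
    by (simp add: xy \<open>c = 0\<close> \<open>d = 0\<close> jac_trilinear xyt)
  then have "0 \<cdot> x + 0 \<cdot> y + b \<cdot> t + 1 \<cdot> u = 0"
    by simp
  from indep4D(4)[OF ind this] show False by simp
qed

text \<open>With \<open>z = br x y\<close>, the linearized Malcev identity for \<open>x\<close> and \<open>z\<close> at \<open>t\<close> and \<open>y\<close> reads
  \<open>- 3 t = 3 t\<close>.\<close>

lemma jac_eigen_1:
  assumes "jac t x y = t"
  shows "t = 0"
proof (rule ccontr)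
  assume nz: "t \<noteq> 0"
  have xt: "br x t = 0"
    using br_eigen_eq_0[OF assms nz] .
  \<comment> \<open>The pair y, -x satisfies the same hypothesis as x, y.\<close>
  have "jac t y (- x) = t"
    using assms jac_skew23[of t x y] by (simp add: jac_trilinear)
  then have yt: "br y t = 0"
    using br_eigen_eq_0 nz by blast
  define z where "z = br x y"
  have xyt: "jac x y t = t"
    using assms jac_cyclic[of x y t] by simp
  have zt: "br z t = 3 \<cdot> t"
    using jacobiator[of x y t] by (simp add: xt yt br_skew[of t x] br_bilinear z_def xyt)
  have "jac y (br y x) t = 0"
    using malcev[of y x t] jac_skew12[of y x t] by (simp add: xyt br_bilinear yt)
  then have "jac y z t = 0"
    using br_skew[of y x] by (simp add: z_def jac_trilinear)
  then have zty: "jac z t y = 0"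
    using jac_cyclic[of z t y] by simp
  have xty: "jac x t y = - t"
    using jac_skew12[of x t y] assms by simp
  have "jac x (br z t) y + jac z (br x t) y = - br x (jac z t y) - br z (jac x t y)"
    by (rule malcev_linearized)
  then have "- (3 \<cdot> t) = 3 \<cdot> t"
    by (simp add: zt xt zty xty br_bilinear jac_trilinear)
  then show False
    using eq_uminus_self_iff[of "3 \<cdot> t"] nz by simp
qed

lemma jac_eigen:
  assumes "jac t x y = k \<cdot> t" "k \<noteq> 0"
  shows "t = 0"
  using jac_eigen_1[of t "(1 / k) \<cdot> x" y] assms by (simp add: jac_trilinear)

text \<open>Replacing one argument of \<open>jac\<close> by the value t expressed as this
  combination makes t an eigenvector with eigenvalue a, -b or c; if t is nonzero,
  \<open>jac_eigen\<close> forces all three to vanish, and then t = 0 after all.\<close>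

lemma jac_in_span:
  assumes "jac w x y = a \<cdot> w + b \<cdot> x + c \<cdot> y"
  shows "jac w x y = 0"
proof (rule ccontr)
  define t where "t = jac w x y"
  assume "jac w x y \<noteq> 0"
  then have nz: "t \<noteq> 0" by (simp add: t_def)
  have t: "t = a \<cdot> w + b \<cdot> x + c \<cdot> y"
    using assms t_def by simp
  have J: "jac w x y = t" "jac x w y = - t" "jac y w x = t"
    using jac_skew12[of x w y] jac_cyclic[of y w x] jac_cyclic[of x y w]
    by (simp_all add: t_def)
  have "jac t x y = a \<cdot> t"
    by (subst t) (simp add: jac_trilinear J)
  then have "a = 0" using jac_eigen nz by blast
  have "jac t w y = (- b) \<cdot> t"
    by (subst t) (simp add: jac_trilinear J)
  then have "b = 0" using jac_eigen nz by (metis neg_equal_0_iff_equal)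
  have "jac t w x = c \<cdot> t"
    by (subst t) (simp add: jac_trilinear J)
  then have "c = 0" using jac_eigen nz by blast
  then show False using nz t \<open>a = 0\<close> \<open>b = 0\<close> by simp
qed

text \<open>A relation involving t would put t into the span of w, x, y, against
  \<open>jac_in_span\<close>; alternation extracts the other coefficients.\<close>

lemma indep4_jac:
  assumes t: "jac w x y = t" "t \<noteq> 0"
  shows "indep4 w x y t"
  unfolding indep4_def
proof (intro allI impI)
  fix k l m n assume eq: "k \<cdot> w + l \<cdot> x + m \<cdot> y + n \<cdot> t = 0"
  have "n = 0"
  proof (rule ccontr)
    assume "n \<noteq> 0"
    have "n \<cdot> t = (- k) \<cdot> w + (- l) \<cdot> x + (- m) \<cdot> y"
      using eq by (simp add: eq_neg_iff_add_eq_0 algebra_simps)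
    then have "(1 / n) \<cdot> n \<cdot> t = (1 / n) \<cdot> ((- k) \<cdot> w + (- l) \<cdot> x + (- m) \<cdot> y)"
      by (rule arg_cong)
    then have "t = (- k / n) \<cdot> w + (- l / n) \<cdot> x + (- m / n) \<cdot> y"
      using \<open>n \<noteq> 0\<close> by (simp add: scale_right_distrib scale_right_diff_distrib)
    then have "jac w x y = (- k / n) \<cdot> w + (- l / n) \<cdot> x + (- m / n) \<cdot> y"
      using t by simp
    from jac_in_span[OF this] show False using t by simp
  qed
  then have eq: "k \<cdot> w + l \<cdot> x + m \<cdot> y = 0" using eq by simp
  have "jac (k \<cdot> w + l \<cdot> x + m \<cdot> y) x y = 0" "jac w (k \<cdot> w + l \<cdot> x + m \<cdot> y) y = 0"
    "jac w x (k \<cdot> w + l \<cdot> x + m \<cdot> y) = 0"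
    by (simp_all add: eq jac_trilinear)
  then show "k = 0 \<and> l = 0 \<and> m = 0 \<and> n = 0"
    using \<open>n = 0\<close> t by (simp add: jac_trilinear)
qed

text \<open>The scalar \<open>s\<close> is chosen such that \<open>t + s w\<close> is an eigenvector of \<open>jac x y\<close> modulo
  the span of \<open>x\<close> and \<open>y\<close>, so that \<open>jac_in_span\<close> applies.\<close>

lemma jac_jac_eq_0:
  assumes t: "jac w x y = t" "t \<noteq> 0"
  shows "jac x y t = 0"
proof -
  obtain d a b c where xyt: "jac x y t = d \<cdot> w + a \<cdot> x + b \<cdot> y + c \<cdot> t"
    using indep4_obtain[OF indep4_jac[OF t]] .
  \<comment> \<open>A root of s^2 + c s = d, which exists over the complex numbers.\<close>
  define s where "s = (csqrt (c\<^sup>2 + 4 * d) - c) / 2"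
  have "(2 * s + c)\<^sup>2 = c\<^sup>2 + 4 * d"
    by (simp add: s_def field_simps)
  then have "4 * d = 4 * (s * (c + s))"
    by (simp add: power2_eq_square algebra_simps)
  then have s: "d = s * (c + s)"
    by simp
  have xyw: "jac x y w = t"
    using t jac_cyclic[of x y w] by simp
  have 0: "jac x y (t + s \<cdot> w) = a \<cdot> x + b \<cdot> y + (c + s) \<cdot> (t + s \<cdot> w)"
    by (simp add: jac_trilinear xyt xyw s algebra_simps)
  from jac_in_span[OF 0] have 1: "jac x y t + s \<cdot> t = 0"
    by (simp add: jac_trilinear xyw)
  \<comment> \<open>Now t itself is an eigenvector for -s, so \<open>jac_eigen\<close> leaves only s
    = 0.\<close>
  then have "jac x y t = (- s) \<cdot> t"
    by (simp add: eq_neg_iff_add_eq_0)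
  then have "jac t x y = (- s) \<cdot> t"
    using jac_cyclic[of x y t] by simp
  then have "s = 0" using jac_eigen t(2) by (metis neg_equal_0_iff_equal)
  then show ?thesis using 1 by simp
qed

text \<open>As \<open>jac w t y\<close> vanishes, \<open>malcev\<close> at w, x, y sees only the
  x-coordinate of \<open>br w x\<close>. Used for all rotations of the triple, this shows that t
  spans an ideal for the bracket.\<close>

lemma br_jac_ex:
  assumes t: "jac w x y = t" "t \<noteq> 0"
  shows "\<exists>k. br w t = k \<cdot> t"
proof -
  obtain a b c d where wx: "br w x = a \<cdot> w + b \<cdot> x + c \<cdot> y + d \<cdot> t"
    using indep4_obtain[OF indep4_jac[OF t]] .
  have "jac x y w = t"
    using t jac_cyclic[of x y w] by simp
  then have "jac w t y = 0"
    using jac_jac_eq_0[of x y w t] t(2) jac_cyclic[of w t y] by simp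
  then have "jac w (br w x) y = b \<cdot> t"
    by (simp add: wx jac_trilinear t)
  then have "br w t = (- b) \<cdot> t"
    using malcev[of w x y] t by (simp add: minus_equation_iff[of "br w t"])
  then show ?thesis ..
qed

text \<open>The brackets of w, x, y with t are scalar multiples of t. If one scalar is nonzero, a
  rotation puts its vector first, and multiples of that vector are subtracted from the other two,
  which preserves \<open>jac\<close>.\<close>

lemma jac_basis:
  assumes "jac w x y \<noteq> 0"
  obtains w' x' y' t where "t \<noteq> 0" "jac w' x' y' = t" "br x' t = 0" "br y' t = 0"
proof -
  define t where "t = jac w x y"
  have nz: "t \<noteq> 0" using assms by (simp add: t_def)
  note result = that[OF nz]
  have *: thesis if J: "jac w x y = t" and k: "br w t = k \<cdot> t" "br x t = l \<cdot> t" "br y t = m \<cdot> t"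
    and "k \<noteq> 0" for w x y k l m
  proof (rule result[of w "x - (l / k) \<cdot> w" "y - (m / k) \<cdot> w"])
    show "jac w (x - (l / k) \<cdot> w) (y - (m / k) \<cdot> w) = t"
      using J by (simp add: jac_trilinear)
    show "br (x - (l / k) \<cdot> w) t = 0" "br (y - (m / k) \<cdot> w) t = 0"
      using k \<open>k \<noteq> 0\<close> by (simp_all add: br_bilinear)
  qed
  have J: "jac w x y = t" "jac x y w = t" "jac y w x = t"
    using jac_cyclic[of x y w] jac_cyclic[of y w x] by (simp_all add: t_def)
  obtain k where kw: "br w t = k \<cdot> t"
    using br_jac_ex[OF J(1) nz] by blast
  obtain l where kx: "br x t = l \<cdot> t"
    using br_jac_ex[OF J(2) nz] by blast
  obtain m where ky: "br y t = m \<cdot> t"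
    using br_jac_ex[OF J(3) nz] by blast
  show thesis
  proof (cases "k = 0 \<and> l = 0 \<and> m = 0")
    case True
    then show ?thesis using result[OF J(1)] kx ky by simp
  next
    case False
    then consider "k \<noteq> 0" | "l \<noteq> 0" | "m \<noteq> 0" by blast
    then show ?thesis
    proof cases
      case 1
      show ?thesis by (rule *[OF J(1) kw kx ky 1])
    next
      case 2
      show ?thesis by (rule *[OF J(2) kx ky kw 2])
    next
      case 3
      show ?thesis by (rule *[OF J(3) ky kw kx 3])
    qed
  qed
qed

end

section \<open>Normal form of the bracket\<close>

context semi_alternative_algebra_4
begin

lemma br_normal_form:
  assumes "jac p q r \<noteq> 0"
  obtains e1 e2 e3 e4 where "indep4 e1 e2 e3 e4"
    "br e1 e2 = 2 \<cdot> e3" "br e1 e3 = 0" "br e2 e3 = 0"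
    "br e1 e4 = 2 \<cdot> e1" "br e2 e4 = 2 \<cdot> e2" "br e3 e4 = - (2 \<cdot> e3)"
proof -
  obtain w x y t where t: "t \<noteq> 0" and wxy: "jac w x y = t" and xt: "br x t = 0" and yt: "br y t = 0"
    using jac_basis[OF assms] .
  have tx: "br t x = 0" and ty: "br t y = 0"
    using xt yt br_skew[of t x] br_skew[of t y] by simp_all
  have ind: "indep4 w x y t"
    using indep4_jac[OF wxy t] .
  have xyw: "jac x y w = t" and ywx: "jac y w x = t"
    using wxy jac_cyclic[of x y w] jac_cyclic[of y w x] by simp_all
  have xwy: "jac x w y = - t" and yxw: "jac y x w = - t" and wyx: "jac w y x = - t"
    using wxy xyw ywx jac_skew12[of x w y] jac_skew12[of y x w] jac_skew12[of w y x] by simp_all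
  have xyt: "jac x y t = 0" and ywt: "jac y w t = 0" and wxt: "jac w x t = 0"
    using jac_jac_eq_0 t wxy xyw ywx by blast+
  have xtw: "jac x t w = 0" and ytw: "jac y t w = 0" and wty: "jac w t y = 0"
    and wtx: "jac w t x = 0" and xty: "jac x t y = 0" and ytx: "jac y t x = 0"
    using xyt ywt wxt jac_cyclic[of w x t] jac_skew23[of y t w] jac_skew23[of w t y]
      jac_skew23[of w t x] jac_skew23[of x t y] jac_cyclic[of y t x]
      jac_cyclic[of x t w] jac_cyclic[of t y w] jac_cyclic[of w t y] by simp_all
  note J = xt yt tx ty wxy xyw ywx xwy yxw wyx xyt ywt wxt xtw ytw wty wtx xty ytx
  obtain \<alpha> \<beta> \<gamma> \<delta> where xy: "br x y = \<alpha> \<cdot> w + \<beta> \<cdot> x + \<gamma> \<cdot> y + \<delta> \<cdot> t"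
    using indep4_obtain[OF ind] .
  have yx: "br y x = - (\<alpha> \<cdot> w + \<beta> \<cdot> x + \<gamma> \<cdot> y + \<delta> \<cdot> t)"
    using br_skew[of y x] xy by simp
  \<comment> \<open>Inserted into \<open>jac\<close> next to two of w, x, y, a bracket keeps only
    its coordinate along the third, since \<open>jac\<close> vanishes on t. So each use of
    \<open>malcev\<close> below determines one coordinate.\<close>
  have "\<gamma> = 0"
    using malcev[of x y w] t by (simp add: xy J jac_trilinear br_bilinear)
  have "\<beta> = 0"
    using malcev[of y x w] t by (simp add: yx J jac_trilinear br_bilinear)
  obtain a \<mu> c d where wx: "br w x = a \<cdot> w + \<mu> \<cdot> x + c \<cdot> y + d \<cdot> t"
    using indep4_obtain[OF ind] .
  have xw: "br x w = - (a \<cdot> w + \<mu> \<cdot> x + c \<cdot> y + d \<cdot> t)"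
    using br_skew[of x w] wx by simp
  have "c = 0"
    using malcev[of w x x] t by (simp add: wx J jac_trilinear br_bilinear)
  have "a = 0"
    using malcev[of x w y] t by (simp add: xw J jac_trilinear br_bilinear)
  have wt: "br w t = - (\<mu> \<cdot> t)"
    using malcev[of w x y] by (simp add: wx J jac_trilinear minus_equation_iff[of "br w t"])
  obtain a' b' l' d' where wy: "br w y = a' \<cdot> w + b' \<cdot> x + l' \<cdot> y + d' \<cdot> t"
    using indep4_obtain[OF ind] .
  have yw: "br y w = - (a' \<cdot> w + b' \<cdot> x + l' \<cdot> y + d' \<cdot> t)"
    using br_skew[of y w] wy by simp
  have "b' = 0"
    using malcev[of w y y] t by (simp add: wy J jac_trilinear br_bilinear)
  have "a' = 0"
    using malcev[of y w x] t by (simp add: yw J jac_trilinear br_bilinear)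
  have "l' = \<mu>"
    using malcev[of w y x] t by (simp add: wy J jac_trilinear br_bilinear wt)
  have tw: "br t w = \<mu> \<cdot> t"
    using br_skew[of t w] wt by simp
  \<comment> \<open>The Jacobiator of w, x, y is 3 t; its w- and t-coordinates give \<alpha> = 0 and
    \<mu> \<delta> = 1.\<close>
  have "(2 * \<mu> * \<alpha>) \<cdot> w + 0 \<cdot> x + 0 \<cdot> y + (3 * \<mu> * \<delta>) \<cdot> t = 3 \<cdot> t"
  proof -
    have "3 \<cdot> t = br (br w x) y + br (br x y) w + br (br y w) x"
      using jacobiator[of w x y] wxy by simp
    also have "\<dots> = \<mu> \<cdot> (\<alpha> \<cdot> w + \<delta> \<cdot> t) + \<delta> \<cdot> \<mu> \<cdot> t + \<mu> \<cdot> (\<alpha> \<cdot> w + \<delta> \<cdot> t)"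
      by (simp add: wx xy yw yx tw ty tx br_bilinear \<open>\<gamma> = 0\<close> \<open>\<beta> = 0\<close> \<open>a = 0\<close> \<open>c = 0\<close> \<open>a' = 0\<close>
          \<open>b' = 0\<close> \<open>l' = \<mu>\<close> algebra_simps)
    finally show ?thesis
      by (simp add: algebra_simps flip: scale_left_distrib)
  qed
  then have "(2 * \<mu> * \<alpha>) \<cdot> w + 0 \<cdot> x + 0 \<cdot> y + (3 * \<mu> * \<delta> - 3) \<cdot> t = 0"
    by (simp add: algebra_simps)
  from indep4D[OF ind this] have \<mu>\<delta>: "\<mu> * \<delta> = 1" and "\<alpha> = 0"
    by auto
  then have \<mu>0: "\<mu> \<noteq> 0" and \<delta>0: "\<delta> \<noteq> 0" by auto
  \<comment> \<open>The shifts along t make e1 and e2 eigenvectors of the bracket with w; the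
    factors in e3 and e4 normalize the structure constants to 2 and -2.\<close>
  define e1 where "e1 = x + (d / (2 * \<mu>)) \<cdot> t"
  define e2 where "e2 = y + (d' / (2 * \<mu>)) \<cdot> t"
  define e3 where "e3 = (\<delta> / 2) \<cdot> t"
  define e4 where "e4 = - ((2 / \<mu>) \<cdot> w)"
  show thesis
  proof (rule that[of e1 e2 e3 e4])
    show "indep4 e1 e2 e3 e4"
      unfolding indep4_def
    proof (intro allI impI)
      fix k l m n assume "k \<cdot> e1 + l \<cdot> e2 + m \<cdot> e3 + n \<cdot> e4 = 0"
      then have "(- n * 2 / \<mu>) \<cdot> w + k \<cdot> x + l \<cdot> y
          + (k * d / (2 * \<mu>) + l * d' / (2 * \<mu>) + m * \<delta> / 2) \<cdot> t = 0"
        by (simp add: e1_def e2_def e3_def e4_def algebra_simps)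
      from indep4D[OF ind this] show "k = 0 \<and> l = 0 \<and> m = 0 \<and> n = 0"
        using \<mu>0 \<delta>0 by simp
    qed
    show "br e1 e2 = 2 \<cdot> e3" "br e1 e3 = 0" "br e2 e3 = 0"
      by (simp_all add: e1_def e2_def e3_def br_bilinear J xy \<open>\<alpha> = 0\<close> \<open>\<beta> = 0\<close> \<open>\<gamma> = 0\<close>)
    have half: "(2 * k / \<mu> - k / \<mu>) \<cdot> t = 2 \<cdot> (k / (2 * \<mu>)) \<cdot> t" for k
      by (simp add: field_simps)
    have "(k * 2 / \<mu>) \<cdot> t = (k / \<mu>) \<cdot> t + (k / \<mu>) \<cdot> t" for k
      by (simp flip: scale_left_distrib)
    then have "br e1 e4 = 2 \<cdot> x + (2 * d / \<mu> - d / \<mu>) \<cdot> t"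
      "br e2 e4 = 2 \<cdot> y + (2 * d' / \<mu> - d' / \<mu>) \<cdot> t"
      using \<mu>0
      by (simp_all add: e1_def e2_def e4_def br_bilinear xw yw tw \<open>a = 0\<close> \<open>c = 0\<close>
          \<open>a' = 0\<close> \<open>b' = 0\<close> \<open>l' = \<mu>\<close> algebra_simps)
    then show "br e1 e4 = 2 \<cdot> e1" "br e2 e4 = 2 \<cdot> e2"
      unfolding half e1_def e2_def by (simp_all only: scale_right_distrib)
    show "br e3 e4 = - (2 \<cdot> e3)"
      using \<mu>0 by (simp add: e3_def e4_def br_bilinear tw)
  qed
qed

section \<open>The anticommutator and the multiplication table\<close>

text \<open>The family of multiplication tables with a parameter \<open>\<sigma>\<close> that is 1 for S01, S02, S03 and
  - 1 for S04, S05, S06.\<close>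

definition table :: "complex \<Rightarrow> complex \<Rightarrow> complex \<Rightarrow> complex \<Rightarrow> 'a \<Rightarrow> 'a \<Rightarrow> 'a \<Rightarrow> 'a \<Rightarrow> bool" where
  "table \<sigma> p q r e1 e2 e3 e4 \<longleftrightarrow>
    mul e1 e1 = 0 \<and> mul e1 e2 = e3 \<and> mul e1 e3 = 0 \<and> mul e1 e4 = (1 + \<sigma>) \<cdot> e1 + (q / 4) \<cdot> e3 \<and>
    mul e2 e1 = - e3 \<and> mul e2 e2 = 0 \<and> mul e2 e3 = 0 \<and> mul e2 e4 = (1 + \<sigma>) \<cdot> e2 - (p / 4) \<cdot> e3 \<and>
    mul e3 e1 = 0 \<and> mul e3 e2 = 0 \<and> mul e3 e3 = 0 \<and> mul e3 e4 = (\<sigma> - 1) \<cdot> e3 \<and>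
    mul e4 e1 = (\<sigma> - 1) \<cdot> e1 + (q / 4) \<cdot> e3 \<and> mul e4 e2 = (\<sigma> - 1) \<cdot> e2 - (p / 4) \<cdot> e3 \<and>
    mul e4 e3 = (1 + \<sigma>) \<cdot> e3 \<and> mul e4 e4 = p \<cdot> e1 + q \<cdot> e2 + r \<cdot> e3 + (2 * \<sigma>) \<cdot> e4"

lemma mul_br_ac: "2 \<cdot> mul x y = br x y + ac x y"
  by (simp add: br_def ac_def scale_2)

lemma table_exists:
  assumes ind: "indep4 e1 e2 e3 e4"
    and B: "br e1 e2 = 2 \<cdot> e3" "br e1 e3 = 0" "br e2 e3 = 0"
      "br e1 e4 = 2 \<cdot> e1" "br e2 e4 = 2 \<cdot> e2" "br e3 e4 = - (2 \<cdot> e3)"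
  obtains \<sigma> p q r where "\<sigma>\<^sup>2 = 1" "table \<sigma> p q r e1 e2 e3 e4"
proof -
  define V where "V a b c d = a \<cdot> e1 + b \<cdot> e2 + c \<cdot> e3 + d \<cdot> e4" for a b c d
  have V_add: "V a b c d + V a' b' c' d' = V (a + a') (b + b') (c + c') (d + d')"
    and V_diff: "V a b c d - V a' b' c' d' = V (a - a') (b - b') (c - c') (d - d')"
    and V_minus: "- V a b c d = V (- a) (- b) (- c) (- d)"
    and V_scale: "k \<cdot> V a b c d = V (k * a) (k * b) (k * c) (k * d)"
    and V_0: "0 = V 0 0 0 0"
    for a b c d a' b' c' d' k
    by (simp_all add: V_def algebra_simps)
  note V = V_add V_diff V_minus V_scale
  have V_iff: "V a b c d = V a' b' c' d' \<longleftrightarrow> a = a' \<and> b = b' \<and> c = c' \<and> d = d'" for a b c d a' b' c' d'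
    unfolding V_def by (rule indep4_eq_iff[OF ind])
  have V_ex: "\<exists>a b c d. v = V a b c d" for v
    unfolding V_def using indep4_obtain[OF ind] by metis
  have B': "br e2 e1 = - (2 \<cdot> e3)" "br e3 e1 = 0" "br e3 e2 = 0"
      "br e4 e1 = - (2 \<cdot> e1)" "br e4 e2 = - (2 \<cdot> e2)" "br e4 e3 = 2 \<cdot> e3"
    using B br_skew[of e2 e1] br_skew[of e3 e1] br_skew[of e3 e2] br_skew[of e4] by simp_all
  have Vb: "br (V a b c d) e1 = V (- 2 * d) 0 (- 2 * b) 0" "br (V a b c d) e2 = V 0 (- 2 * d) (2 * a) 0"
    "br (V a b c d) e3 = V 0 0 (2 * d) 0" "br (V a b c d) e4 = V (2 * a) (2 * b) (- 2 * c) 0" for a b c d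
    by (simp_all add: V_def br_bilinear B B' algebra_simps)
  have bV: "br e1 (V a b c d) = V (2 * d) 0 (2 * b) 0" "br e2 (V a b c d) = V 0 (2 * d) (- 2 * a) 0"
    "br e3 (V a b c d) = V 0 0 (- 2 * d) 0" "br e4 (V a b c d) = V (- 2 * a) (- 2 * b) (2 * c) 0" for a b c d
    by (simp_all add: V_def br_bilinear B B' algebra_simps)
  have V_eq_0: "V a b c d = 0 \<longleftrightarrow> a = 0 \<and> b = 0 \<and> c = 0 \<and> d = 0" for a b c d
    by (metis V_0 V_iff)
  note R = B B' ac_commute[of e2 e1] ac_commute[of e3 e1] ac_commute[of e3 e2] ac_commute[of e4 e1]
    ac_commute[of e4 e2] ac_commute[of e4 e3] ac_bilinear Vb bV V V_iff V_eq_0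
  obtain p q r s where a44: "ac e4 e4 = V p q r s"
    using V_ex by blast
  \<comment> \<open>For each i < 4, \<open>ac_br\<close> at e4, e4, ei is a linear system whose only
    solution expresses \<open>ac ei e4\<close> by the coordinates of
    \<open>ac e4 e4\<close>.\<close>
  have a14: "ac e1 e4 = V (s / 2) 0 (q / 4) 0"
  proof -
    obtain a b c d where a: "ac e1 e4 = V a b c d"
      using V_ex by blast
    show ?thesis
      using ac_br[of e4 e4 e1] by (simp add: R a a44 mult.commute)
  qed
  have a24: "ac e2 e4 = V 0 (s / 2) (- p / 4) 0"
  proof -
    obtain a b c d where a: "ac e2 e4 = V a b c d"
      using V_ex by blast
    have eqs: "a = 0" "2 * b = s" "16 * c + 4 * p = 0" "d = 0"
      using ac_br[of e4 e4 e2] by (simp_all add: R a a44)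
    have "4 * (4 * c + p) = 0"
      using eqs(3) by simp
    then have "p = - (4 * c)"
      by (simp add: add_eq_0_iff)
    then show ?thesis
      using eqs by (simp add: a V_iff mult.commute)
  qed
  have a34: "ac e3 e4 = V 0 0 (s / 2) 0"
  proof -
    obtain a b c d where a: "ac e3 e4 = V a b c d"
      using V_ex by blast
    show ?thesis
      using ac_br[of e4 e4 e3] by (simp add: R a a44)
  qed
  \<comment> \<open>The remaining anticommutators vanish: each is the unknown in an instance of
    \<open>ac_br\<close> that involves e4 and the values just found.\<close>
  have a11: "ac e1 e1 = V 0 0 0 0"
  proof -
    obtain a b c d where a: "ac e1 e1 = V a b c d"
      using V_ex by blast
    show ?thesis
      using ac_br[of e1 e1 e4] by (simp add: R a a14)
  qed
  have a22: "ac e2 e2 = V 0 0 0 0"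
  proof -
    obtain a b c d where a: "ac e2 e2 = V a b c d"
      using V_ex by blast
    show ?thesis
      using ac_br[of e2 e2 e4] by (simp add: R a a24)
  qed
  have a33: "ac e3 e3 = V 0 0 0 0"
  proof -
    obtain a b c d where a: "ac e3 e3 = V a b c d"
      using V_ex by blast
    show ?thesis
      using ac_br[of e3 e3 e4] by (simp add: R a a34)
  qed
  have a12: "ac e1 e2 = V 0 0 0 0"
  proof -
    obtain a b c d where a: "ac e1 e2 = V a b c d"
      using V_ex by blast
    show ?thesis
      using ac_br[of e1 e2 e4] by (simp add: R a a14 a24)
  qed
  have a13: "ac e1 e3 = V 0 0 0 0"
  proof -
    obtain a b c d where a: "ac e1 e3 = V a b c d"
      using V_ex by blast
    show ?thesis
      using ac_br[of e4 e1 e3] by (simp add: R a a14 a34)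
  qed
  have a23: "ac e2 e3 = V 0 0 0 0"
  proof -
    obtain a b c d where a: "ac e2 e3 = V a b c d"
      using V_ex by blast
    show ?thesis
      using ac_br[of e4 e2 e3] by (simp add: R a a24 a34)
  qed
  \<comment> \<open>\<open>ac e4 e4\<close> is twice the square of e4, and the e4-coordinate of that
    square is to be 2 \<sigma>.\<close>
  define \<sigma> P Q R where "\<sigma> = s / 4" and "P = p / 2" and "Q = q / 2" and "R = r / 2"
  have half: "mul x y = (1 / 2) \<cdot> (br x y + ac x y)" for x y
    by (simp flip: mul_br_ac)
  have zeros: "ac e1 e1 = 0" "ac e2 e2 = 0" "ac e3 e3 = 0" "ac e1 e2 = 0" "ac e1 e3 = 0" "ac e2 e3 = 0"
    "ac e2 e1 = 0" "ac e3 e1 = 0" "ac e3 e2 = 0"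
    using a11 a22 a33 a12 a13 a23 ac_commute[of e2 e1] ac_commute[of e3 e1] ac_commute[of e3 e2]
    by (simp_all add: V_0)
  have a4: "ac e4 e1 = V (s / 2) 0 (q / 4) 0" "ac e4 e2 = V 0 (s / 2) (- p / 4) 0"
    "ac e4 e3 = V 0 0 (s / 2) 0"
    using a14 a24 a34 ac_commute[of e4 e1] ac_commute[of e4 e2] ac_commute[of e4 e3] by simp_all
  have basis_V: "e1 = V 1 0 0 0" "e2 = V 0 1 0 0" "e3 = V 0 0 1 0" "e4 = V 0 0 0 1"
    by (simp_all add: V_def)
  have tab: "table \<sigma> P Q R e1 e2 e3 e4"
    unfolding table_def half zeros a14 a24 a34 a4 a44 B B' br_self
    unfolding basis_V
    by (simp add: V V_iff V_eq_0 \<sigma>_def P_def Q_def R_def field_simps)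
  have mV: "mul (V a b c d) e4 = V ((1 + \<sigma>) * a + d * P) ((1 + \<sigma>) * b + d * Q)
      (a * Q / 4 - b * P / 4 + (\<sigma> - 1) * c + d * R) (2 * \<sigma> * d)"
    "mul e4 (V a b c d) = V ((\<sigma> - 1) * a + d * P) ((\<sigma> - 1) * b + d * Q)
      (a * Q / 4 - b * P / 4 + (1 + \<sigma>) * c + d * R) (2 * \<sigma> * d)"
    "mul (V a b c d) e1 = V ((\<sigma> - 1) * d) 0 (d * Q / 4 - b) 0"
    "mul e1 (V a b c d) = V ((1 + \<sigma>) * d) 0 (d * Q / 4 + b) 0" for a b c d
    unfolding V_def by (simp_all add: tab[unfolded table_def] mul_bilinear algebra_simps)
  have m: "mul e4 e4 = V P Q R (2 * \<sigma>)" "mul e1 e4 = V (1 + \<sigma>) 0 (Q / 4) 0"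
    "mul e4 e1 = V (\<sigma> - 1) 0 (Q / 4) 0"
    using tab unfolding table_def V_def by simp_all
  \<comment> \<open>The e1-coordinates of the two sides are \<sigma>^2 - 1 and 1 -
    \<sigma>^2.\<close>
  have "associator mul e4 e4 e1 = associator mul e1 e4 e4"
    by (rule assoc_cyclic)
  then have "(\<sigma> - 1) * (2 * \<sigma>) - (\<sigma> - 1) * (\<sigma> - 1) = (1 + \<sigma>) * (1 + \<sigma>) - (1 + \<sigma>) * (2 * \<sigma>)"
    by (simp add: associator_def m mV V_diff V_iff)
  then have "2 * \<sigma>\<^sup>2 = 2 * 1"
    by (simp add: power2_eq_square algebra_simps)
  then have "\<sigma>\<^sup>2 = 1" by simp
  then show thesis using that tab by blast
qed

end

section \<open>Isomorphisms within the family of products on \<open>complex ^ 4\<close>\<close>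

lemma algebra_isomorphic_sym:
  assumes "algebra_isomorphic s m s' m'"
  shows "algebra_isomorphic s' m' s m"
proof -
  obtain f where f: "Vector_Spaces.linear s s' f" "bij f" "\<And>x y. f (m x y) = m' (f x) (f y)"
    using assms unfolding algebra_isomorphic_def by blast
  interpret f: Vector_Spaces.linear s s' f by (rule f(1))
  have inv: "inv f (f x) = x" "f (inv f y) = y" for x y
    using f(2) by (simp_all add: bij_is_inj bij_is_surj surj_f_inv_f)
  have "Vector_Spaces.linear s' s (inv f)"
  proof (rule Vector_Spaces.linear.intro)
    show "module_hom s' s (inv f)"
      by unfold_locales (metis inv f.add, metis inv f.scale)
  qed unfold_locales
  moreover have "inv f (m' x y) = m (inv f x) (inv f y)" for x y
    using f(3)[of "inv f x" "inv f y"] inv by metis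
  ultimately show ?thesis
    unfolding algebra_isomorphic_def using f(2) bij_imp_bij_inv by blast
qed

lemma algebra_isomorphic_trans:
  assumes "algebra_isomorphic s m s' m'" "algebra_isomorphic s' m' s'' m''"
  shows "algebra_isomorphic s m s'' m''"
proof -
  obtain f where f: "Vector_Spaces.linear s s' f" "bij f" "\<And>x y. f (m x y) = m' (f x) (f y)"
    using assms(1) unfolding algebra_isomorphic_def by blast
  obtain g where g: "Vector_Spaces.linear s' s'' g" "bij g" "\<And>x y. g (m' x y) = m'' (g x) (g y)"
    using assms(2) unfolding algebra_isomorphic_def by blast
  have "Vector_Spaces.linear s s'' (g \<circ> f)"
    using f(1) g(1) by (rule Vector_Spaces.linear_compose)
  moreover have "bij (g \<circ> f)"
    using f(2) g(2) by (rule bij_comp)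
  moreover have "(g \<circ> f) (m x y) = m'' ((g \<circ> f) x) ((g \<circ> f) y)" for x y
    by (simp add: f(3) g(3))
  ultimately show ?thesis
    unfolding algebra_isomorphic_def by blast
qed

definition vec4 :: "complex \<Rightarrow> complex \<Rightarrow> complex \<Rightarrow> complex \<Rightarrow> complex ^ 4" where
  "vec4 a b c d = a *s e 1 + b *s e 2 + c *s e 3 + d *s e 4"

lemma vec4_nth [simp]:
  "vec4 a b c d $ 1 = a" "vec4 a b c d $ 2 = b" "vec4 a b c d $ 3 = c" "vec4 a b c d $ 4 = d"
  by (simp_all add: vec4_def axis_def)

text \<open>The product for which the standard basis satisfies the relations of
  \<open>table\<close>, expanded in coordinates.\<close>

definition family_mul ::
  "complex \<Rightarrow> complex \<Rightarrow> complex \<Rightarrow> complex \<Rightarrow> complex ^ 4 \<Rightarrow> complex ^ 4 \<Rightarrow> complex ^ 4" where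
  "family_mul \<sigma> p q r v w = vec4
     ((1 + \<sigma>) * (v $ 1 * w $ 4) + (\<sigma> - 1) * (v $ 4 * w $ 1) + p * (v $ 4 * w $ 4))
     ((1 + \<sigma>) * (v $ 2 * w $ 4) + (\<sigma> - 1) * (v $ 4 * w $ 2) + q * (v $ 4 * w $ 4))
     (v $ 1 * w $ 2 - v $ 2 * w $ 1 + q / 4 * (v $ 1 * w $ 4 + v $ 4 * w $ 1)
       - p / 4 * (v $ 2 * w $ 4 + v $ 4 * w $ 2) + (\<sigma> - 1) * (v $ 3 * w $ 4)
       + (1 + \<sigma>) * (v $ 4 * w $ 3) + r * (v $ 4 * w $ 4))
     (2 * \<sigma> * (v $ 4 * w $ 4))"

lemma family_mul_S:
  "family_mul 1 0 0 0 = S01" "family_mul 1 (- 4) 0 0 = S02" "family_mul 1 0 0 1 = S03"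
  "family_mul (- 1) 0 0 0 = S04" "family_mul (- 1) (- 4) 0 0 = S05" "family_mul (- 1) 0 0 1 = S06"
  unfolding fun_eq_iff vec_eq_iff forall_4 S01_def S02_def S03_def S04_def S05_def S06_def
  by (simp_all add: family_mul_def table_mul_def sum_4 axis_def algebra_simps)

text \<open>For all parameters the e3-coordinates of the associators of e1, e2, e4 and of e2, e1, e4
  are -2 and 2.\<close>

lemma not_assosymmetric_family_mul: "\<not> assosymmetric (family_mul \<sigma> p q r)"
proof
  assume "assosymmetric (family_mul \<sigma> p q r)"
  then have "associator (family_mul \<sigma> p q r) (e 1) (e 2) (e 4) $ 3
      = associator (family_mul \<sigma> p q r) (e 2) (e 1) (e 4) $ 3"
    unfolding assosymmetric_def by metis
  then show False
    by (simp add: associator_def family_mul_def axis_def)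
qed

lemma family_mul_isomorphicI:
  fixes g :: "complex ^ 4 \<Rightarrow> complex ^ 4"
  assumes "Vector_Spaces.linear (*s) (*s) g" "\<And>v. g v = 0 \<Longrightarrow> v = 0"
    and "\<And>v w. g (family_mul \<sigma> p q r v w) = family_mul \<sigma> p' q' r' (g v) (g w)"
  shows "algebra_isomorphic (*s) (family_mul \<sigma> p q r) (*s) (family_mul \<sigma> p' q' r')"
proof -
  have "inj g"
    using assms(1,2) vec.linear_inj_iff_eq_0 by blast
  then have "bij g"
    using assms(1) vec.linear_inj_imp_surj by (auto simp: bij_def)
  then show ?thesis
    unfolding algebra_isomorphic_def using assms by blast
qed

text \<open>\<open>det\<close> gives the new e1, e2 determinant 1 in the plane of the old ones, so
  their product remains e3 up to sign conventions of the table; translating e4 by m and n absorbs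
  r.\<close>

lemma family_mul_reduce:
  assumes det: "p * v - q * u = - 4" and r: "p * n - q * m = r"
  shows "algebra_isomorphic (*s) (family_mul \<sigma> (- 4) 0 0) (*s) (family_mul \<sigma> p q r)"
proof -
  \<comment> \<open>The images of the basis. The e3-coordinates -r/8 and (u n - v m)/2 are those
    required by the products of e1 and e2 with e4.\<close>
  define g where "g x = x $ 1 *s vec4 (- p / 4) (- q / 4) (- r / 8) 0
    + x $ 2 *s vec4 u v ((u * n - v * m) / 2) 0 + x $ 3 *s vec4 0 0 1 0
    + x $ 4 *s vec4 m n 0 1" for x :: "complex ^ 4"
  show ?thesis
  proof (rule family_mul_isomorphicI)
    show "Vector_Spaces.linear (*s) (*s) g"
      by (rule Vector_Spaces.linear.intro, unfold_locales) (simp_all add: g_def algebra_simps)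
    show "x = 0" if "g x = 0" for x
    proof -
      have *: "x $ 4 = 0" "x $ 1 * (- p / 4) + x $ 2 * u = 0" "x $ 1 * (- q / 4) + x $ 2 * v = 0"
        "x $ 1 * (- r / 8) + x $ 2 * ((u * n - v * m) / 2) + x $ 3 = 0"
      proof -
        have **: "g x $ 1 = 0" "g x $ 2 = 0" "g x $ 3 = 0" "g x $ 4 = 0"
          using that by simp_all
        show "x $ 4 = 0"
          using **(4) by (simp add: g_def)
        then show "x $ 1 * (- p / 4) + x $ 2 * u = 0" "x $ 1 * (- q / 4) + x $ 2 * v = 0"
          "x $ 1 * (- r / 8) + x $ 2 * ((u * n - v * m) / 2) + x $ 3 = 0"
          using **(1-3) by (simp_all add: g_def)
      qed
      \<comment> \<open>Cramer's rule for the first two coordinates, whose determinant is nonzero by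
        \<open>det\<close>.\<close>
      have "x $ 1 * (p * v - q * u) = - 4 * (v * (x $ 1 * (- p / 4) + x $ 2 * u)
          - u * (x $ 1 * (- q / 4) + x $ 2 * v))"
        by (simp add: field_simps)
      then have 1: "x $ 1 = 0"
        unfolding * det by simp
      have "x $ 2 * (p * v - q * u) = p * (x $ 1 * (- q / 4) + x $ 2 * v)
          - q * (x $ 1 * (- p / 4) + x $ 2 * u)"
        by (simp add: field_simps)
      then have "x $ 2 = 0"
        unfolding * det by simp
      then show ?thesis
        using 1 * by (simp add: vec_eq_iff forall_4)
    qed
    show "g (family_mul \<sigma> (- 4) 0 0 x y) = family_mul \<sigma> p q r (g x) (g y)" for x y
      unfolding vec_eq_iff forall_4
    proof (intro conjI)
      \<comment> \<open>Only this coordinate uses the hypotheses: after substituting for r, the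
        defect is a multiple of p v - q u + 4. The others agree identically.\<close>
      show "g (family_mul \<sigma> (- 4) 0 0 x y) $ 3 = family_mul \<sigma> p q r (g x) (g y) $ 3"
      proof -
        have "g (family_mul \<sigma> (- 4) 0 0 x y) $ 3 - family_mul \<sigma> p q r (g x) (g y) $ 3
          = (p * v - q * u + 4) / 4
            * (x $ 1 * y $ 2 - x $ 2 * y $ 1 + x $ 2 * y $ 4 + x $ 4 * y $ 2)"
          unfolding g_def family_mul_def r[symmetric] by (simp add: field_simps)
        then show ?thesis by (simp add: det)
      qed
    qed (simp_all add: g_def family_mul_def field_simps)
  qed
qed

text \<open>Scaling e1 and e3 by r preserves all products except the e3-part of the square of
  e4.\<close>

lemma family_mul_scale:
  assumes "r \<noteq> 0"
  shows "algebra_isomorphic (*s) (family_mul \<sigma> 0 0 1) (*s) (family_mul \<sigma> 0 0 r)"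
proof -
  define g where "g x = vec4 (r * x $ 1) (x $ 2) (r * x $ 3) (x $ 4)" for x :: "complex ^ 4"
  show ?thesis
  proof (rule family_mul_isomorphicI)
    show "Vector_Spaces.linear (*s) (*s) g"
      by (rule Vector_Spaces.linear.intro, unfold_locales)
        (simp_all add: g_def vec_eq_iff forall_4 algebra_simps)
  qed (use assms in \<open>simp_all add: g_def family_mul_def vec_eq_iff forall_4 algebra_simps\<close>)
qed

text \<open>A nonzero (p, q) can be moved to (-4, 0) while absorbing r; otherwise only whether r is
  zero matters. The two signs of \<sigma> then give six algebras.\<close>

lemma family_mul_isomorphic_S:
  assumes "\<sigma>\<^sup>2 = 1"
  shows "\<exists>T \<in> {S01, S02, S03, S04, S05, S06}.
    algebra_isomorphic (*s) (family_mul \<sigma> p q r) (*s) T"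
proof -
  have \<sigma>: "\<sigma> = 1 \<or> \<sigma> = - 1"
    using assms by (simp add: power2_eq_1_iff)
  have refl: "algebra_isomorphic (*s) m (*s) m" for m :: "complex ^ 4 \<Rightarrow> complex ^ 4 \<Rightarrow> complex ^ 4"
    unfolding algebra_isomorphic_def using vec.linear_id bij_id by (metis id_apply)
  have "\<exists>(p', r') \<in> {(0, 0), (- 4, 0), (0, 1)}.
      algebra_isomorphic (*s) (family_mul \<sigma> p q r) (*s) (family_mul \<sigma> p' 0 r')"
  proof (cases "p = 0 \<and> q = 0")
    case True
    then show ?thesis
      using refl family_mul_scale[of r \<sigma>, THEN algebra_isomorphic_sym] by (cases "r = 0") auto
  next
    case False
    then consider "p \<noteq> 0" | "q \<noteq> 0" by blast
    then obtain u v m n where "p * v - q * u = - 4" "p * n - q * m = r"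
    proof cases
      case 1
      \<comment> \<open>The instantiations are for v, u, n, m in this order.\<close>
      then show thesis by (intro that[of "- 4 / p" 0 "r / p" 0]) simp_all
    next
      case 2
      then show thesis by (intro that[of 0 "4 / q" 0 "- r / q"]) simp_all
    qed
    from family_mul_reduce[OF this, of \<sigma>, THEN algebra_isomorphic_sym] show ?thesis by simp
  qed
  then obtain p' r' where "(p', r') \<in> {(0, 0), (- 4, 0), (0, 1)}"
    and iso: "algebra_isomorphic (*s) (family_mul \<sigma> p q r) (*s) (family_mul \<sigma> p' 0 r')"
    by blast
  then have "family_mul \<sigma> p' 0 r' \<in> {S01, S02, S03, S04, S05, S06}"
    using \<sigma> by (auto simp: family_mul_S)
  then show ?thesis using iso by blast
qed

section \<open>Assembling the classification\<close>

context semi_alternative_algebra_4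
begin

lemma table_isomorphic:
  assumes ind: "indep4 e1 e2 e3 e4" and tab: "table \<sigma> p q r e1 e2 e3 e4"
  shows "algebra_isomorphic (*s) (family_mul \<sigma> p q r) scale mul"
proof -
  let ?f = "comb4 e1 e2 e3 e4"
  have "?f (family_mul \<sigma> p q r v w) = mul (?f v) (?f w)" for v w
    unfolding comb4_def family_mul_def
    by (simp add: tab[unfolded table_def] mul_bilinear algebra_simps)
  then show ?thesis
    unfolding algebra_isomorphic_def using linear_comb4 bij_comb4[OF ind] by blast
qed

lemma assosymmetric_or_isomorphic_S:
  "assosymmetric mul \<or> (\<exists>T \<in> {S01, S02, S03, S04, S05, S06}. algebra_isomorphic scale mul (*s) T)"
proof (cases "\<forall>x y z. jac x y z = 0")
  case True
  then have "associator mul x y z = associator mul y x z" for x y z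
    by (simp add: jac_def)
  \<comment> \<open>Vanishing of \<open>jac\<close> is symmetry in the first two arguments; the
    other equation of assosymmetry is cyclicity.\<close>
  then show ?thesis
    unfolding assosymmetric_def using assoc_cyclic by metis
next
  case False
  then obtain e1 e2 e3 e4 where ind: "indep4 e1 e2 e3 e4" and
    "br e1 e2 = 2 \<cdot> e3" "br e1 e3 = 0" "br e2 e3 = 0"
    "br e1 e4 = 2 \<cdot> e1" "br e2 e4 = 2 \<cdot> e2" "br e3 e4 = - (2 \<cdot> e3)"
    using br_normal_form by metis
  then obtain \<sigma> p q r where \<sigma>: "\<sigma>\<^sup>2 = 1" and tab: "table \<sigma> p q r e1 e2 e3 e4"
    using table_exists by blast
  obtain T where "T \<in> {S01, S02, S03, S04, S05, S06}"
    "algebra_isomorphic (*s) (family_mul \<sigma> p q r) (*s) T"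
    using family_mul_isomorphic_S[OF \<sigma>] by blast
  then show ?thesis
    using table_isomorphic[OF ind tab, THEN algebra_isomorphic_sym] algebra_isomorphic_trans by blast
qed

end

theorem theorem31:
  fixes scale :: "complex \<Rightarrow> 'a::ab_group_add \<Rightarrow> 'a"
    and mul :: "'a \<Rightarrow> 'a \<Rightarrow> 'a"
  assumes "complex_algebra scale mul"
    and "vector_space.dim scale (UNIV :: 'a set) = 4"
    and "semi_alternative mul"
  shows "(assosymmetric mul \<or>
          (\<exists>T \<in> {S01, S02, S03, S04, S05, S06}. algebra_isomorphic scale mul (*s) T)) \<and>
         (\<forall>T \<in> {S01, S02, S03, S04, S05, S06}. \<not> assosymmetric T)"
proof
  interpret complex_algebra scale mul by fact
  interpret semi_alternative_algebra_4 scale mul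
    using assms by unfold_locales
  show "assosymmetric mul \<or>
      (\<exists>T \<in> {S01, S02, S03, S04, S05, S06}. algebra_isomorphic scale mul (*s) T)"
    by (rule assosymmetric_or_isomorphic_S)
  show "\<forall>T \<in> {S01, S02, S03, S04, S05, S06}. \<not> assosymmetric T"
    using not_assosymmetric_family_mul by (simp flip: family_mul_S)
qed

end
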